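(* Let $\lambda$ be a cardinal with $2^{<\lambda}=\lambda>\omega$. Let $Y\subseteq{}^{\lambda}2$. Then there is no continuous weak $\lambda^+$-measure space $(Y,\mathfrak{M},\mu)$ (for any choice of positively totally ordered monoid $\mathbb{S}$ with infinitary sum $\mathsf{Sum}$ in which $\mu$ takes its values).
   Context: **Topology.** ${}^{\lambda}2$ is the set of functions from $\lambda$ to $2=\{0,1\}$, with the bounded topology, generated by the cones $\mathbf{N}_s=\{x\in{}^{\lambda}2\mid s\subseteq x\}$ for $s\in{}^{<\lambda}2=\bigcup_{\alpha<\lambda}{}^{\alpha}2$. Subsets carry the subspace topology. $2^{<\lambda}=\sup\{2^{\theta}\mid\theta<\lambda\text{ a cardinal}\}$. **Monoids and sums.** A positively totally ordered monoid is $\mathbb{S}=(S,0,+,\leq)$ where $+$ is associative (not necessarily commutative) with neutral element $0$, $\leq$ is a total order, $a\leq b$ and $c\leq d$ imply $a+c\leq b+d$, $0$ is the minimum of $\leq$, and $S\neq\{0\}$. ${}^{<\mathrm{On}}\mathbb{S}$ is the class of all sequences of elements of $S$ of ordinal length; $\mathrm{lh}(s)$ is the length of $s$. An infinitary sum on $\mathbb{S}$ is a partial function $\mathsf{Sum}:{}^{<\mathrm{On}}\mathbb{S}\to\mathbb{S}$ such that: (S1) $\mathsf{Sum}(\emptyset)=0$ and $\mathsf{Sum}(s)=s_0+\dots+s_n$ for every non-empty finite $s=(s_i)_{i\leq n}\in\mathrm{dom}(\mathsf{Sum})$; (S2) (continuity) for all $s\in\mathrm{dom}(\mathsf{Sum})$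 of limit length, if $s\restriction\alpha\in\mathrm{dom}(\mathsf{Sum})$ for cofinally many $\alpha<\mathrm{lh}(s)$, then $\mathsf{Sum}(s)=\sup\{\mathsf{Sum}(s\restriction\alpha)\mid\alpha<\mathrm{lh}(s),\ s\restriction\alpha\in\mathrm{dom}(\mathsf{Sum})\}$. **Measures.** A weakly $\lambda^+$-measurable space is a pair $(X,\mathfrak{M})$ where $X$ is a topological space and $\mathfrak{M}$ is a family of subsets of $X$ closed under unions of size $\leq\lambda$ and containing all open subsets of $X$. A $\lambda^+$-measure on it (with values in $(\mathbb{S},\mathsf{Sum})$) is a partial function $\mu:\mathscr{P}(X)\to\mathbb{S}$ with $\mathfrak{M}\subseteq\mathrm{dom}(\mu)$ such that: (M1) $\mu(\emptyset)=0$; (M2) $\mu(X)>0$; (M3) $A\subseteq B$ implies $\mu(A)\leq\mu(B)$ for all $A,B\in\mathfrak{M}$; (M4) for every family $(A_i)_{i<\gamma}$ of pairwise disjoint sets of $\mathfrak{M}$ of length an ordinal $\gamma<\lambda^+$, we have $\langle\mu(A_i)\mid i<\gamma\rangle\in\mathrm{dom}(\mathsf{Sum})$ and $\mu(\bigcup_{i<\gamma}A_i)=\mathsf{Sum}(\langle\mu(A_i)\mid i<\gamma\rangle)$; (M5) for every $x\in X$ with $\{x\}\in\mathfrak{M}$ and every open local basis $\{A_i\mid i<\gamma\}$ at $x$ with $\gamma<\lambda^+$, $\mu(\{x\})=\inf_{i<\gamma}\mu(A_i)$. Then $(X,\mathfrak{M},\mu)$ is called a weak $\lambda^+$-measure space.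 It is continuous if $\{x\}\in\mathfrak{M}$ and $\mu(\{x\})=0$ for every $x\in X$. *)

theory Defs
  imports "HOL-Analysis.Analysis" "HOL-Library.Lub_Glb"
begin

unbundle cardinal_syntax

text \<open>
  Ordinals are the elements of a well-ordered type \<open>'o\<close>, the ordinal \<open>\<alpha>\<close> being identified with
  the set \<open>{..<\<alpha>}\<close> of its predecessors. The theorem assumes \<open>'o\<close> to be long enough to contain the
  cardinal successor of the cardinal under consideration; apart from that, \<open>'o\<close> is arbitrary.
  A sequence of length \<open>\<alpha>\<close> is a map with domain \<open>{..<\<alpha>}\<close>, so that equality and inclusion of
  sequences are equality and inclusion (\<open>\<subseteq>\<^sub>m\<close>) of maps, and \<open>s |` {..<\<beta>}\<close> is the restriction to
  \<open>\<beta>\<close>.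
\<close>

subsection \<open>Ordinals and cardinals\<close>

definition is_cardinal :: "'o::wellorder \<Rightarrow> bool" where
  "is_cardinal \<kappa> \<longleftrightarrow> (\<forall>\<beta><\<kappa>. |{..<\<beta>}| <o |{..<\<kappa>}| )"

definition is_limit :: "'o::wellorder \<Rightarrow> bool" where
  "is_limit \<alpha> \<longleftrightarrow> (\<exists>\<beta>. \<beta> < \<alpha>) \<and> (\<forall>\<beta><\<alpha>. \<exists>\<delta>. \<beta> < \<delta> \<and> \<delta> < \<alpha>)"

text \<open>Meaningful only if \<open>'o\<close> has an element of cardinality greater than that of \<open>\<kappa>\<close>.\<close>

definition card_succ :: "'o::wellorder \<Rightarrow> 'o" where
  "card_succ \<kappa> = (LEAST \<nu>. |{..<\<kappa>}| <o |{..<\<nu>}| )"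

text \<open>
  \<open>is_two_pow_less \<kappa> \<nu>\<close> says \<open>2\<^sup><\<^sup>\<kappa> = \<nu>\<close>: the cardinal \<open>\<nu>\<close> is the supremum of the cardinals \<open>2\<^sup>\<theta>\<close>
  for cardinals \<open>\<theta> < \<kappa>\<close>. A relation is used since \<open>2\<^sup>\<theta>\<close> need not be represented in \<open>'o\<close>.
\<close>

definition two_pow_less_bound :: "'o::wellorder \<Rightarrow> 'o \<Rightarrow> bool" where
  "two_pow_less_bound \<kappa> \<nu> \<longleftrightarrow>
     is_cardinal \<nu> \<and> (\<forall>\<theta><\<kappa>. is_cardinal \<theta> \<longrightarrow> ctwo ^c |{..<\<theta>}| \<le>o |{..<\<nu>}| )"

definition is_two_pow_less :: "'o::wellorder \<Rightarrow> 'o \<Rightarrow> bool" where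
  "is_two_pow_less \<kappa> \<nu> \<longleftrightarrow>
     two_pow_less_bound \<kappa> \<nu> \<and> (\<forall>\<nu>'. two_pow_less_bound \<kappa> \<nu>' \<longrightarrow> \<nu> \<le> \<nu>')"

subsection \<open>The generalized Cantor space\<close>

definition cantor :: "'o::wellorder \<Rightarrow> ('o \<rightharpoonup> bool) set" where
  "cantor \<kappa> = {x. dom x = {..<\<kappa>}}"

definition cone :: "'o::wellorder \<Rightarrow> ('o \<rightharpoonup> bool) \<Rightarrow> ('o \<rightharpoonup> bool) set" where
  "cone \<kappa> s = {x \<in> cantor \<kappa>. s \<subseteq>\<^sub>m x}"

definition bounded_topology :: "'o::wellorder \<Rightarrow> ('o \<rightharpoonup> bool) topology" where
  "bounded_topology \<kappa> = topology_generated_by (cone \<kappa> ` (\<Union>\<alpha>\<in>{..<\<kappa>}. cantor \<alpha>))"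

subsection \<open>Monoids and infinitary sums\<close>

class pos_tot_ordered_monoid = monoid_add + linorder +
  assumes add_mono_both: "a \<le> b \<Longrightarrow> c \<le> d \<Longrightarrow> a + c \<le> b + d"
    and zero_minimum: "0 \<le> a"
    and not_trivial: "\<exists>a. a \<noteq> 0"

definition infinitary_sum ::
  "(('o::wellorder \<rightharpoonup> 's::pos_tot_ordered_monoid) \<rightharpoonup> 's) \<Rightarrow> bool" where
  "infinitary_sum isum \<longleftrightarrow>
     (\<forall>s \<in> dom isum. \<exists>\<alpha>. dom s = {..<\<alpha>}) \<and>
     isum Map.empty = Some 0 \<and>
     (\<forall>s \<in> dom isum. dom s \<noteq> {} \<and> finite (dom s) \<longrightarrow>
        isum s = Some (sum_list (map (the \<circ> s) (sorted_list_of_set (dom s))))) \<and>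
     (\<forall>s \<in> dom isum. \<forall>\<alpha>. dom s = {..<\<alpha>} \<and> is_limit \<alpha> \<and>
        (\<forall>\<beta><\<alpha>. \<exists>\<delta>. \<beta> \<le> \<delta> \<and> \<delta> < \<alpha> \<and> s |` {..<\<delta>} \<in> dom isum) \<longrightarrow>
        isLub UNIV {the (isum (s |` {..<\<delta>})) | \<delta>. \<delta> < \<alpha> \<and> s |` {..<\<delta>} \<in> dom isum} (the (isum s)))"

subsection \<open>Measures\<close>

definition weakly_measurable_space ::
  "'o::wellorder \<Rightarrow> 'x topology \<Rightarrow> 'x set set \<Rightarrow> bool" where
  "weakly_measurable_space \<kappa> X M \<longleftrightarrow>
     M \<subseteq> Pow (topspace X) \<and>
     (\<forall>\<A>. \<A> \<subseteq> M \<and> |\<A>| \<le>o |{..<\<kappa>}| \<longrightarrow> \<Union>\<A> \<in> M) \<and>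
     (\<forall>U. openin X U \<longrightarrow> U \<in> M)"

definition open_local_basis :: "'x topology \<Rightarrow> 'x \<Rightarrow> 'x set set \<Rightarrow> bool" where
  "open_local_basis X x \<B> \<longleftrightarrow>
     (\<forall>B\<in>\<B>. openin X B \<and> x \<in> B) \<and> (\<forall>U. openin X U \<and> x \<in> U \<longrightarrow> (\<exists>B\<in>\<B>. B \<subseteq> U))"

text \<open>The cardinal \<open>\<kappa>\<close> plays the role of \<open>\<lambda>\<close>: the measures below are \<open>\<lambda>\<^sup>+\<close>-measures.\<close>

locale weak_measure_space =
  fixes \<kappa> :: "'o::wellorder"
    and X :: "'x topology"
    and M :: "'x set set"
    and isum :: "('o \<rightharpoonup> 's::pos_tot_ordered_monoid) \<rightharpoonup> 's"
    and \<mu> :: "'x set \<rightharpoonup> 's"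
  assumes measurable_space: "weakly_measurable_space \<kappa> X M"
    and infinitary_sum: "infinitary_sum isum"
    and dom_measure: "M \<subseteq> dom \<mu>" "dom \<mu> \<subseteq> Pow (topspace X)"
    and M1: "\<mu> {} = Some 0"
    and M2: "the (\<mu> (topspace X)) > 0"
    and M3: "\<And>A B. A \<in> M \<Longrightarrow> B \<in> M \<Longrightarrow> A \<subseteq> B \<Longrightarrow> the (\<mu> A) \<le> the (\<mu> B)"
    and M4: "\<And>\<gamma> A. \<gamma> < card_succ \<kappa> \<Longrightarrow> A ` {..<\<gamma>} \<subseteq> M \<Longrightarrow> disjoint_family_on A {..<\<gamma>} \<Longrightarrow>
      (\<lambda>i. \<mu> (A i)) |` {..<\<gamma>} \<in> dom isum \<and>
      \<mu> (\<Union>i\<in>{..<\<gamma>}. A i) = isum ((\<lambda>i. \<mu> (A i)) |` {..<\<gamma>})"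
    and M5: "\<And>x \<gamma> A. x \<in> topspace X \<Longrightarrow> {x} \<in> M \<Longrightarrow> \<gamma> < card_succ \<kappa> \<Longrightarrow>
      open_local_basis X x (A ` {..<\<gamma>}) \<Longrightarrow>
      isGlb UNIV ((\<lambda>i. the (\<mu> (A i))) ` {..<\<gamma>}) (the (\<mu> {x}))"

locale continuous_weak_measure_space = weak_measure_space +
  assumes continuous: "\<And>x. x \<in> topspace X \<Longrightarrow> {x} \<in> M \<and> \<mu> {x} = Some 0"

end

theory Submission
  imports Defs
begin

text \<open>
  Suppose all finite multiples of \<open>c\<close> are at most \<open>d\<close>. By rearrangement and continuity of sums, every
  disjoint union of at most \<open>\<kappa>\<close> sets of measure at most \<open>c\<close> has measure at most \<open>d\<close>. For \<open>c = d = 0\<close>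
  this makes small unions of null sets null. Since \<open>Y\<close> is a disjoint union of at most \<open>\<kappa>\<close> cones of
  measure at most \<open>c\<close> for any given \<open>c > 0\<close>, it also makes the monoid archimedean below \<open>\<mu> Y\<close>: the
  multiples of each \<open>c > 0\<close> exceed every \<open>d < \<mu> Y\<close>. In a cone \<open>C\<close> of measure less than \<open>\<mu> Y\<close>, a
  disjoint family of sets of measure at least \<open>c\<close> is therefore finite. Infinitely many disjoint
  positive pieces of \<open>C\<close> then yield positive values \<open>c\<^sub>k\<close> coinitial in the positive elements, so
  disjoint families of positive sets in \<open>C\<close> are countable. Up to a null set, every point of \<open>C\<close> is
  determined by the cones it belongs to among the countably many positive maximal cones of measure
  below some \<open>c\<^sub>k\<close>. Hence, up to a null set, \<open>C\<close> has at most \<open>2\<^sup>\<omega> \<le> \<kappa>\<close> points, and it is null.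
\<close>

subsection \<open>Cardinalities of initial segments\<close>

lemma card_of_insert_ordIso:
  assumes "infinite A"
  shows "|insert a A| =o |A|"
proof (cases "a \<in> A")
  case True
  then show ?thesis by (simp add: insert_absorb card_of_refl)
next
  case False
  with infinite_imp_bij_betw2[OF assms, of a] show ?thesis
    using card_of_ordIso ordIso_symmetric by fastforce
qed

text \<open>M4 and M5 speak of index ordinals below \<open>card_succ \<kappa>\<close>, whereas the
  arguments below control cardinalities. The first hypothesis ensures that the \<open>LEAST\<close>
  in \<open>card_succ\<close> is attained.\<close>

lemma less_card_succ:
  fixes \<kappa> :: "'o::wellorder"
  assumes "\<exists>\<nu>::'o. |{..<\<kappa>}| <o |{..<\<nu>}|" "|{..<\<gamma>}| \<le>o |{..<\<kappa>}|"
  shows "\<gamma> < card_succ \<kappa>"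
proof (rule ccontr)
  assume "\<not> \<gamma> < card_succ \<kappa>"
  then have "|{..<card_succ \<kappa>}| \<le>o |{..<\<gamma>}|" by (intro card_of_mono1) auto
  moreover have "|{..<\<kappa>}| <o |{..<card_succ \<kappa>}|"
    unfolding card_succ_def using assms(1) by (rule LeastI_ex)
  ultimately show False
    using assms(2) not_ordLess_ordLeq ordLeq_transitive by blast
qed

text \<open>A largest \<beta> below \<gamma> would leave only one new point in the segment of
  \<gamma>, and one point does not change an infinite cardinality.\<close>

lemma is_limit_if_segments_smaller:
  fixes \<gamma> :: "'o::wellorder"
  assumes "infinite {..<\<gamma>}" and small: "\<And>\<beta>. \<beta> < \<gamma> \<Longrightarrow> \<not> |{..<\<gamma>}| \<le>o |{..<\<beta>}|"
  shows "is_limit \<gamma>"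
proof (rule ccontr)
  assume "\<not> is_limit \<gamma>"
  moreover have "\<exists>\<beta>. \<beta> < \<gamma>" using assms(1) by (metis finite.emptyI lessThan_iff subsetI subset_empty)
  ultimately obtain \<beta> where \<beta>: "\<beta> < \<gamma>" "\<And>\<delta>. \<beta> < \<delta> \<Longrightarrow> \<not> \<delta> < \<gamma>"
    unfolding is_limit_def by blast
  then have eq: "{..<\<gamma>} = insert \<beta> {..<\<beta>}" by (force simp: not_less le_less)
  with assms(1) have "infinite {..<\<beta>}" by simp
  then have "|{..<\<gamma>}| \<le>o |{..<\<beta>}|"
    unfolding eq by (intro ordIso_imp_ordLeq card_of_insert_ordIso)
  with small \<beta>(1) show False by blast
qed

lemma ordLess_card_of_iff: "|A| <o |B| \<longleftrightarrow> \<not> |B| \<le>o |A|"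
  by (rule not_ordLeq_iff_ordLess[OF card_of_Well_order card_of_Well_order, symmetric])

lemma is_limit_if_cardinal:
  assumes "is_cardinal \<kappa>" "infinite {..<\<kappa>}"
  shows "is_limit \<kappa>"
  using assms unfolding is_cardinal_def ordLess_card_of_iff
  by (simp add: is_limit_if_segments_smaller)

text \<open>The least \<theta> whose segment is at least as large works. This reduces arbitrary
  levels to cardinals, the only exponents that \<open>is_two_pow_less\<close> mentions.\<close>

lemma ex_cardinal_ordIso:
  fixes \<alpha> :: "'o::wellorder"
  obtains \<theta> where "\<theta> \<le> \<alpha>" "is_cardinal \<theta>" "|{..<\<alpha>}| \<le>o |{..<\<theta>}|"
proof -
  define \<theta> :: 'o where "\<theta> = (LEAST \<theta>. |{..<\<alpha>}| \<le>o |{..<\<theta>}| )"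
  have 1: "|{..<\<alpha>}| \<le>o |{..<\<theta>}|"
    unfolding \<theta>_def by (rule LeastI_ex) (blast intro: card_of_mono1[OF order_refl])
  have 2: "\<theta> \<le> \<alpha>" unfolding \<theta>_def by (rule Least_le) (simp add: card_of_mono1)
  have "is_cardinal \<theta>"
    unfolding is_cardinal_def ordLess_card_of_iff
  proof (intro allI impI notI)
    fix \<beta> assume "\<beta> < \<theta>" "|{..<\<theta>}| \<le>o |{..<\<beta>}|"
    with 1 have "|{..<\<alpha>}| \<le>o |{..<\<beta>}|" using ordLeq_transitive by blast
    then have "\<theta> \<le> \<beta>" unfolding \<theta>_def by (rule Least_le)
    with \<open>\<beta> < \<theta>\<close> show False by simp
  qed
  with 1 2 show ?thesis using that by blast
qed

section \<open>Power sets of initial segments, and small segments\<close>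

lemma cexp_ctwo_eq_Pow: "ctwo ^c |A| =o |Pow A|"
  unfolding cexp_def ctwo_def Field_card_of by (rule ordIso_symmetric[OF card_of_Pow_Func])

lemma card_of_Pow_mono: "|A| \<le>o |B| \<Longrightarrow> |Pow A| \<le>o |Pow B|"
  unfolding card_of_ordLeq[symmetric]
  by (metis image_Pow_mono inj_on_image_Pow)

lemma card_of_Pow_segment:
  fixes \<kappa> :: "'o::wellorder"
  assumes "is_two_pow_less \<kappa> \<kappa>" "\<alpha> < \<kappa>"
  shows "|Pow {..<\<alpha>}| \<le>o |{..<\<kappa>}|"
proof -
  obtain \<theta> where \<theta>: "\<theta> \<le> \<alpha>" "is_cardinal \<theta>" "|{..<\<alpha>}| \<le>o |{..<\<theta>}|"
    by (rule ex_cardinal_ordIso)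
  with assms have "ctwo ^c |{..<\<theta>}| \<le>o |{..<\<kappa>}|"
    unfolding is_two_pow_less_def two_pow_less_bound_def by auto
  then have "|Pow {..<\<theta>}| \<le>o |{..<\<kappa>}|"
    using cexp_ctwo_eq_Pow ordIso_ordLeq_trans ordIso_symmetric by blast
  with card_of_Pow_mono[OF \<theta>(3)] show ?thesis using ordLeq_transitive by blast
qed

text \<open>If all smaller segments were finite, their sizes would embed \<kappa> into the natural
  numbers. Such a segment later bounds the power set of a countable set by \<kappa>.\<close>

lemma ex_infinite_segment_less:
  fixes \<kappa> :: "'o::wellorder"
  assumes "natLeq <o |{..<\<kappa>}|"
  shows "\<exists>\<theta><\<kappa>. infinite {..<\<theta>}"
proof (rule ccontr)
  assume "\<not> ?thesis"
  then have fin: "finite {..<\<theta>}" if "\<theta> < \<kappa>" for \<theta> using that by blast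
  have "inj_on (\<lambda>\<theta>. card {..<\<theta>}) {..<\<kappa>}"
  proof (rule linorder_inj_onI')
    fix \<theta> \<theta>' assume "\<theta> \<in> {..<\<kappa>}" "\<theta>' \<in> {..<\<kappa>}" "\<theta> < \<theta>'"
    then have "card {..<\<theta>} < card {..<\<theta>'}"
      by (intro psubset_card_mono fin) auto
    then show "card {..<\<theta>} \<noteq> card {..<\<theta>'}" by simp
  qed
  then have "|{..<\<kappa>}| \<le>o |UNIV :: nat set|" by (auto intro: card_of_ordLeqI)
  then have "|{..<\<kappa>}| \<le>o natLeq" using card_of_nat ordLeq_ordIso_trans by blast
  with assms show False using not_ordLess_ordLeq by blast
qed

lemma ex_segment_insert:
  fixes y :: "'o::wellorder"
  assumes "infinite {..<\<kappa>::'o}" "finite {..<y}"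
  shows "\<exists>z. {..<z} = insert y {..<y}"
proof -
  have "\<exists>x. y < x"
  proof (rule ccontr)
    assume "\<not> ?thesis"
    then have "{..<\<kappa>} \<subseteq> insert y {..<y}" by (force simp: not_less le_less)
    with assms show False using finite_subset by blast
  qed
  then have "y < (LEAST x. y < x)" by (rule LeastI_ex)
  moreover have "x \<le> y" if "x < (LEAST x. y < x)" for x using not_less_Least[OF that] by simp
  ultimately have "{..<LEAST x. y < x} = insert y {..<y}" by (auto simp: le_less)
  then show ?thesis by blast
qed

subsection \<open>Small disjoint unions\<close>

abbreviation multiple :: "nat \<Rightarrow> 'a::monoid_add \<Rightarrow> 'a" where
  "multiple n c \<equiv> sum_list (replicate n c)"

lemma multiple_zero [simp]: "multiple n (0 :: 'a::monoid_add) = 0"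
  by (induction n) auto

text \<open>The setting of all additivity arguments, independent of the topology:
  \<open>card_succ \<kappa>\<close> is a genuine successor, and finite families are short enough for
  M4.\<close>

locale infinite_weak_measure_space = weak_measure_space \<kappa> X M isum \<mu>
  for \<kappa> :: "'o::wellorder"
    and X :: "'x topology"
    and M :: "'x set set"
    and isum :: "('o \<rightharpoonup> 's::pos_tot_ordered_monoid) \<rightharpoonup> 's"
    and \<mu> :: "'x set \<rightharpoonup> 's" +
  assumes ex_larger: "\<exists>\<nu>::'o. |{..<\<kappa>}| <o |{..<\<nu>}|"
    and infinite_segment: "infinite {..<\<kappa>}"
begin

abbreviation m where "m A \<equiv> the (\<mu> A)"

lemma m_empty [simp]: "m {} = 0" by (simp add: M1)

lemma M_Union: "\<A> \<subseteq> M \<Longrightarrow> |\<A>| \<le>o |{..<\<kappa>}| \<Longrightarrow> \<Union>\<A> \<in> M"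
  and M_open: "openin X U \<Longrightarrow> U \<in> M"
  using measurable_space unfolding weakly_measurable_space_def by blast+

lemma M_empty [simp]: "{} \<in> M" by (simp add: M_open)

lemma M_UN:
  assumes "D ` J \<subseteq> M" "|J| \<le>o |{..<\<kappa>}|"
  shows "(\<Union>j\<in>J. D j) \<in> M"
  using M_Union[OF assms(1)] card_of_image ordLeq_transitive assms(2) by blast

lemma finite_ordLeq: "finite J \<Longrightarrow> |J| \<le>o |{..<\<kappa>}|"
  using infinite_segment finite_ordLess_infinite ordLess_imp_ordLeq by (metis Field_card_of card_of_Well_order)

lemma M_Un:
  assumes "A \<in> M" "B \<in> M"
  shows "A \<union> B \<in> M"
  using M_Union[of "{A, B}"] assms by (simp add: finite_ordLeq)

lemma isum_eq:
  assumes "|{..<\<gamma>}| \<le>o |{..<\<kappa>}|" "A ` {..<\<gamma>} \<subseteq> M" "disjoint_family_on A {..<\<gamma>}"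
  shows "(\<lambda>i. \<mu> (A i)) |` {..<\<gamma>} \<in> dom isum"
    and "isum ((\<lambda>i. \<mu> (A i)) |` {..<\<gamma>}) = \<mu> (\<Union>i<\<gamma>. A i)"
    and "dom ((\<lambda>i. \<mu> (A i)) |` {..<\<gamma>}) = {..<\<gamma>}"
  using M4[OF less_card_succ[OF ex_larger assms(1)] assms(2,3)] assms(2) dom_measure(1) by auto

lemma isum_limit:
  assumes "s \<in> dom isum" "dom s = {..<\<alpha>}" "is_limit \<alpha>"
    and "\<forall>\<beta><\<alpha>. \<exists>\<delta>. \<beta> \<le> \<delta> \<and> \<delta> < \<alpha> \<and> s |` {..<\<delta>} \<in> dom isum"
  shows "isLub UNIV {the (isum (s |` {..<\<delta>})) | \<delta>. \<delta> < \<alpha> \<and> s |` {..<\<delta>} \<in> dom isum} (the (isum s))"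
  using infinitary_sum assms unfolding infinitary_sum_def by (elim conjE) simp

text \<open>M4 for a family of length 2, evaluated by the finite case of the sum. The segment of
  \<open>o2\<close> is listed in increasing order, which matters because addition need not
  commute.\<close>

lemma m_Un:
  assumes A: "A \<in> M" and B: "B \<in> M" and "A \<inter> B = {}"
  shows "m (A \<union> B) = m A + m B"
proof -
  define o0 :: 'o where "o0 = (LEAST x. True)"
  have e0: "{..<o0} = {}" unfolding o0_def using not_less_Least by blast
  obtain o1 where e1: "{..<o1} = {o0}"
    using ex_segment_insert[OF infinite_segment, of o0] e0 by auto
  obtain o2 where e2: "{..<o2} = {o1, o0}"
    using ex_segment_insert[OF infinite_segment, of o1] e1 by auto
  have "o0 < o1" using e1 by blast
  define D where "D i = (if i = o0 then A else B)" for i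
  let ?s = "(\<lambda>i. \<mu> (D i)) |` {..<o2}"
  have D: "D ` {..<o2} \<subseteq> M" "disjoint_family_on D {..<o2}"
    using assms unfolding D_def disjoint_family_on_def e2 by auto
  have card: "|{..<o2}| \<le>o |{..<\<kappa>}|" unfolding e2 by (simp add: finite_ordLeq)
  note s = isum_eq[OF card D]
  have "isum ?s = Some (sum_list (map (the \<circ> ?s) (sorted_list_of_set {..<o2})))"
    using infinitary_sum s(1,3) unfolding infinitary_sum_def e2 by (metis finite.emptyI finite.insertI insert_not_empty)
  also have "\<dots> = Some (m A + m B)"
    using \<open>o0 < o1\<close> unfolding D_def e2 by (auto simp: insort_is_Cons restrict_map_def)
  also have "(\<Union>i\<in>{..<o2}. D i) = A \<union> B" unfolding e2 D_def using \<open>o0 < o1\<close> by auto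
  ultimately show ?thesis using s(2) by simp
qed

text \<open>Induction peels off one summand at a time. Only multiples of a single element are
  compared with, so the order of summation is harmless.\<close>

lemma m_finite_UN:
  assumes "finite J" "D ` J \<subseteq> M" "disjoint_family_on D J"
  shows "(\<forall>j\<in>J. m (D j) \<le> c) \<longrightarrow> m (\<Union>j\<in>J. D j) \<le> multiple (card J) c"
    and "(\<forall>j\<in>J. c \<le> m (D j)) \<longrightarrow> multiple (card J) c \<le> m (\<Union>j\<in>J. D j)"
  using assms
proof (induction J)
  case (insert j J)
  case 1
  have "m (\<Union>i\<in>insert j J. D i) = m (D j) + m (\<Union>i\<in>J. D i)"
    unfolding UN_insert using 1 insert.hyps
    by (intro m_Un M_UN finite_ordLeq) (auto simp: disjoint_family_on_def)
  with 1 insert show ?case by (auto simp: disjoint_family_on_def intro: add_mono_both)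
next
  case (insert j J)
  case 2
  have "m (\<Union>i\<in>insert j J. D i) = m (D j) + m (\<Union>i\<in>J. D i)"
    unfolding UN_insert using 2 insert.hyps
    by (intro m_Un M_UN finite_ordLeq) (auto simp: disjoint_family_on_def)
  with 2 insert show ?case by (auto simp: disjoint_family_on_def intro: add_mono_both)
qed auto

text \<open>
  A family indexed by an ordinal that is not a cardinal is rearranged along a smaller ordinal, so
  continuity of the sum is only needed at infinite cardinals.
\<close>

lemma m_UN_segment_le:
  assumes c: "\<And>n. multiple n c \<le> d"
  shows "\<gamma> \<le> \<kappa> \<Longrightarrow> A ` {..<\<gamma>} \<subseteq> M \<Longrightarrow> disjoint_family_on A {..<\<gamma>} \<Longrightarrow>
    (\<And>i. i < \<gamma> \<Longrightarrow> m (A i) \<le> c) \<Longrightarrow> m (\<Union>i<\<gamma>. A i) \<le> d"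
proof (induction \<gamma> arbitrary: A rule: less_induct)
  case (less \<gamma>)
  consider "finite {..<\<gamma>}" | \<beta> where "\<beta> < \<gamma>" "|{..<\<gamma>}| \<le>o |{..<\<beta>}|"
    | "infinite {..<\<gamma>}" "\<And>\<beta>. \<beta> < \<gamma> \<Longrightarrow> \<not> |{..<\<gamma>}| \<le>o |{..<\<beta>}|" by blast
  then show ?case
  proof cases
    case 1
    then have "m (\<Union>i<\<gamma>. A i) \<le> multiple (card {..<\<gamma>}) c"
      using m_finite_UN(1)[OF 1 less.prems(2,3)] less.prems(4) by auto
    with c show ?thesis by (meson order_trans)
  next
    case 2
    have "|{..<\<beta>}| \<le>o |{..<\<gamma>}|" using 2(1) by (intro card_of_mono1) auto
    with 2(2) have "|{..<\<beta>}| =o |{..<\<gamma>}|" by (simp add: ordIso_iff_ordLeq)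
    then obtain f where f: "bij_betw f {..<\<beta>} {..<\<gamma>}" using card_of_ordIso by blast
    then have "(\<Union>i<\<gamma>. A i) = (\<Union>i<\<beta>. (A \<circ> f) i)"
      by (metis bij_betw_imp_surj_on image_comp)
    also have "m \<dots> \<le> d"
    proof (rule less.IH[OF 2(1)])
      show "\<beta> \<le> \<kappa>" using 2(1) less.prems(1) by simp
      show "(A \<circ> f) ` {..<\<beta>} \<subseteq> M"
        using less.prems(2) f by (metis bij_betw_imp_surj_on image_comp)
      show "disjoint_family_on (A \<circ> f) {..<\<beta>}"
        using less.prems(3) f unfolding disjoint_family_on_def bij_betw_def inj_on_def comp_def
        by (metis imageI)
      show "m ((A \<circ> f) i) \<le> c" if "i < \<beta>" for i
        using less.prems(4) f that bij_betwE by fastforce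
    qed
    finally show ?thesis .
  next
    case 3
    let ?s = "\<lambda>\<delta>. (\<lambda>i. \<mu> (A i)) |` {..<\<delta>}"
    have lim: "is_limit \<gamma>" using 3 by (rule is_limit_if_segments_smaller)
    have prems: "A ` {..<\<delta>} \<subseteq> M" "disjoint_family_on A {..<\<delta>}" if "\<delta> \<le> \<gamma>" for \<delta>
      using less.prems(2,3) that by (force simp: disjoint_family_on_def)+
    have card: "|{..<\<delta>}| \<le>o |{..<\<kappa>}|" if "\<delta> \<le> \<gamma>" for \<delta>
      using that less.prems(1) by (intro card_of_mono1) auto
    have s: "?s \<delta> \<in> dom isum" "isum (?s \<delta>) = \<mu> (\<Union>i<\<delta>. A i)" "dom (?s \<delta>) = {..<\<delta>}"
      if "\<delta> \<le> \<gamma>" for \<delta>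
      using isum_eq[OF card prems] that by auto
    have restr: "?s \<gamma> |` {..<\<delta>} = ?s \<delta>" if "\<delta> < \<gamma>" for \<delta>
      using that by (auto simp: restrict_map_def fun_eq_iff)
    have "isLub UNIV {the (isum (?s \<gamma> |` {..<\<delta>})) | \<delta>. \<delta> < \<gamma> \<and> ?s \<gamma> |` {..<\<delta>} \<in> dom isum} (the (isum (?s \<gamma>)))"
    proof -
      have "\<forall>\<beta><\<gamma>. \<exists>\<delta>. \<beta> \<le> \<delta> \<and> \<delta> < \<gamma> \<and> ?s \<gamma> |` {..<\<delta>} \<in> dom isum"
        using restr s(1) less_imp_le order_refl by (metis (no_types, lifting))
      then show ?thesis by (rule isum_limit[OF s(1)[OF order_refl] s(3)[OF order_refl] lim])
    qed
    \<comment> \<open>The sum is the least upper bound of its partial sums. These are measures of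
      shorter unions, so the induction hypothesis makes d an upper bound.\<close>
    then have "the (isum (?s \<gamma>)) \<le> d"
    proof (rule isLub_le_isUb, intro isUb_UNIV_I)
      fix y assume "y \<in> {the (isum (?s \<gamma> |` {..<\<delta>})) | \<delta>. \<delta> < \<gamma> \<and> ?s \<gamma> |` {..<\<delta>} \<in> dom isum}"
      then obtain \<delta> where \<delta>: "\<delta> < \<gamma>" "y = the (isum (?s \<gamma> |` {..<\<delta>}))" by blast
      then have "y = m (\<Union>i<\<delta>. A i)" using restr s(2)[of \<delta>] by (simp add: less_imp_le)
      also have "\<dots> \<le> d"
        using less.IH[OF \<delta>(1), of A] \<delta>(1) less.prems prems[of \<delta>] by auto
      finally show "y \<le> d" .
    qed
    then show ?thesis using s(2)[OF order_refl] by simp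
  qed
qed

text \<open>An injection of the index set into \<kappa> reduces the claim to families indexed by a
  segment.\<close>

lemma m_UN_le:
  assumes "|J| \<le>o |{..<\<kappa>}|" "D ` J \<subseteq> M" "disjoint_family_on D J"
    and "\<And>j. j \<in> J \<Longrightarrow> m (D j) \<le> c" "\<And>n. multiple n c \<le> d"
  shows "m (\<Union>j\<in>J. D j) \<le> d"
proof -
  obtain f where f: "inj_on f J" "f ` J \<subseteq> {..<\<kappa>}" using assms(1) unfolding card_of_ordLeq[symmetric] by blast
  define A where "A i = (if i \<in> f ` J then D (inv_into J f i) else {})" for i
  have A: "A (f j) = D j" if "j \<in> J" for j using that f(1) by (simp add: A_def)
  have A': "A i = {} \<or> (\<exists>j\<in>J. i = f j \<and> A i = D j)" for i
    using A by (cases "i \<in> f ` J") (auto simp: A_def)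
  have "(\<Union>j\<in>J. D j) = (\<Union>i<\<kappa>. A i)"
  proof (intro equalityI UN_least)
    show "D j \<subseteq> (\<Union>i<\<kappa>. A i)" if "j \<in> J" for j
      using A[OF that] that f(2) by blast
    show "A i \<subseteq> (\<Union>j\<in>J. D j)" for i using A'[of i] by blast
  qed
  also have "m \<dots> \<le> d"
  proof (rule m_UN_segment_le[OF assms(5) order_refl])
    show "A ` {..<\<kappa>} \<subseteq> M"
    proof (intro image_subsetI)
      show "A i \<in> M" for i using A'[of i] assms(2) by auto
    qed
    show "disjoint_family_on A {..<\<kappa>}"
      unfolding disjoint_family_on_def
    proof (intro ballI impI)
      show "A i \<inter> A i' = {}" if "i \<noteq> i'" for i i'
        using A'[of i] A'[of i'] that disjoint_family_onD[OF assms(3)] by fastforce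
    qed
    show "m (A i) \<le> c" for i
      using A'[of i] assms(4) by (auto simp: zero_minimum)
  qed
  finally show ?thesis .
qed

lemma m_UN_null:
  assumes "|J| \<le>o |{..<\<kappa>}|" "D ` J \<subseteq> M" "disjoint_family_on D J"
    and "\<And>j. j \<in> J \<Longrightarrow> m (D j) = 0"
  shows "m (\<Union>j\<in>J. D j) = 0"
  using m_UN_le[OF assms(1-3), of 0 0] assms(4) by (simp add: eq_iff zero_minimum)

end

subsection \<open>Measures on subspaces of the generalized Cantor space\<close>

text \<open>These assumptions are to be refuted: the last lemma of the locale derives
  \<open>False\<close> from them.\<close>

locale continuous_cantor_measure =
  infinite_weak_measure_space \<kappa> "subtopology (bounded_topology \<kappa>) Y" M isum \<mu> +
  continuous_weak_measure_space \<kappa> "subtopology (bounded_topology \<kappa>) Y" M isum \<mu>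
  for \<kappa> :: "'o::wellorder"
    and Y :: "('o \<rightharpoonup> bool) set"
    and M :: "('o \<rightharpoonup> bool) set set"
    and isum :: "('o \<rightharpoonup> 's::pos_tot_ordered_monoid) \<rightharpoonup> 's"
    and \<mu> :: "('o \<rightharpoonup> bool) set \<rightharpoonup> 's" +
  assumes cardinal: "is_cardinal \<kappa>"
    and two_pow_less: "is_two_pow_less \<kappa> \<kappa>"
    and uncountable_segment: "natLeq <o |{..<\<kappa>}|"
    and Y_subset: "Y \<subseteq> cantor \<kappa>"
begin

section \<open>Cones in Y as local bases\<close>

abbreviation X where "X \<equiv> subtopology (bounded_topology \<kappa>) Y"

text \<open>The trace on Y of a cone, given by a centre and a level instead of a sequence. Cones
  with a common point can then be centred there and compared by their levels.\<close>

definition nbhd :: "('o \<rightharpoonup> bool) \<Rightarrow> 'o \<Rightarrow> ('o \<rightharpoonup> bool) set" where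
  "nbhd x \<alpha> = {y \<in> Y. \<forall>\<beta><\<alpha>. y \<beta> = x \<beta>}"

lemma limit: "\<alpha> < \<kappa> \<Longrightarrow> \<exists>\<delta>. \<alpha> < \<delta> \<and> \<delta> < \<kappa>" and pos: "\<exists>\<alpha>. \<alpha> < \<kappa>"
  using is_limit_if_cardinal[OF cardinal infinite_segment] unfolding is_limit_def by blast+

lemma nbhd_self: "x \<in> Y \<Longrightarrow> x \<in> nbhd x \<alpha>"
  and nbhd_subset: "nbhd x \<alpha> \<subseteq> Y"
  and nbhd_antimono: "\<alpha> \<le> \<beta> \<Longrightarrow> nbhd x \<beta> \<subseteq> nbhd x \<alpha>"
  and nbhd_eq: "y \<in> nbhd x \<alpha> \<Longrightarrow> nbhd y \<alpha> = nbhd x \<alpha>"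
  by (auto simp: nbhd_def)

lemma dom_Y: "x \<in> Y \<Longrightarrow> dom x = {..<\<kappa>}"
  using Y_subset by (auto simp: cantor_def)

lemma Y_eqI: "x \<in> Y \<Longrightarrow> y \<in> Y \<Longrightarrow> (\<And>\<beta>. \<beta> < \<kappa> \<Longrightarrow> x \<beta> = y \<beta>) \<Longrightarrow> x = y"
  using dom_Y by (metis domIff ext lessThan_iff)

lemma nbhd_eq_cone:
  assumes "x \<in> Y" "\<alpha> < \<kappa>"
  shows "nbhd x \<alpha> = cone \<kappa> (x |` {..<\<alpha>}) \<inter> Y"
proof -
  have "dom (x |` {..<\<alpha>}) = {..<\<alpha>}" using dom_Y[OF assms(1)] assms(2) by auto
  then have "x |` {..<\<alpha>} \<subseteq>\<^sub>m y \<longleftrightarrow> (\<forall>\<beta><\<alpha>. y \<beta> = x \<beta>)" for y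
    unfolding map_le_def by auto
  then show ?thesis using Y_subset by (auto simp: nbhd_def cone_def)
qed

lemma restrict_in_cantor: "x \<in> Y \<Longrightarrow> \<alpha> < \<kappa> \<Longrightarrow> x |` {..<\<alpha>} \<in> (\<Union>\<alpha>\<in>{..<\<kappa>}. cantor \<alpha>)"
  using dom_Y[of x] by (force simp: cantor_def)

lemma openin_nbhd:
  assumes "x \<in> Y" "\<alpha> < \<kappa>"
  shows "openin X (nbhd x \<alpha>)"
  unfolding nbhd_eq_cone[OF assms] bounded_topology_def
  using restrict_in_cantor[OF assms]
  by (intro openin_subtopology_Int topology_generated_by_Basis) blast

lemma topspace_X: "topspace X = Y"
proof
  show "topspace X \<subseteq> Y" by simp
  show "Y \<subseteq> topspace X" using openin_nbhd pos nbhd_self openin_subset by blast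
qed

text \<open>Induction on the generation of the topology: an intersection takes the larger of two
  levels, and a generating cone contains the cone around x at the length of its sequence.\<close>

lemma openin_imp_nbhd:
  assumes "openin X U" "x \<in> U"
  shows "\<exists>\<alpha><\<kappa>. nbhd x \<alpha> \<subseteq> U"
proof -
  obtain V where V: "openin (bounded_topology \<kappa>) V" "U = V \<inter> Y"
    using assms(1) by (auto simp: openin_subtopology)
  have "generate_topology_on (cone \<kappa> ` (\<Union>\<alpha>\<in>{..<\<kappa>}. cantor \<alpha>)) V"
    using V(1) unfolding bounded_topology_def by (rule openin_topology_generated_by)
  moreover have "x \<in> V" "x \<in> Y" using assms(2) V(2) by auto
  ultimately have "\<exists>\<alpha><\<kappa>. nbhd x \<alpha> \<subseteq> V"
  proof (induction rule: generate_topology_on.induct)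
    case (Int a b)
    then obtain \<alpha> \<beta> where "\<alpha> < \<kappa>" "nbhd x \<alpha> \<subseteq> a" "\<beta> < \<kappa>" "nbhd x \<beta> \<subseteq> b" by auto
    then show ?case
      using nbhd_antimono[of \<alpha> "max \<alpha> \<beta>" x] nbhd_antimono[of \<beta> "max \<alpha> \<beta>" x]
      by (intro exI[of _ "max \<alpha> \<beta>"]) auto
  next
    case (UN K)
    then show ?case by (meson UnionE Union_upper subset_trans)
  next
    case (Basis V)
    then obtain s \<alpha> where s: "V = cone \<kappa> s" "\<alpha> < \<kappa>" "dom s = {..<\<alpha>}" by (auto simp: cantor_def)
    have "nbhd x \<alpha> \<subseteq> V"
    proof
      fix y assume "y \<in> nbhd x \<alpha>"
      then have y: "y \<in> Y" "\<And>\<beta>. \<beta> < \<alpha> \<Longrightarrow> y \<beta> = x \<beta>" by (auto simp: nbhd_def)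
      have "s \<subseteq>\<^sub>m x" using Basis.prems(1) s(1) by (simp add: cone_def)
      then have "s \<subseteq>\<^sub>m y" using y(2) s(3) by (simp add: map_le_def)
      then show "y \<in> V" using y(1) Y_subset s(1) by (auto simp: cone_def)
    qed
    with s(2) show ?case by blast
  qed auto
  then show ?thesis using nbhd_subset V(2) by blast
qed

lemma openin_if_nbhd:
  assumes "U \<subseteq> Y" "\<And>x. x \<in> U \<Longrightarrow> \<exists>\<alpha><\<kappa>. nbhd x \<alpha> \<subseteq> U"
  shows "openin X U"
  by (rule openin_subopen[THEN iffD2]) (meson assms nbhd_self openin_nbhd subsetD)

lemma M_nbhd: "x \<in> Y \<Longrightarrow> \<alpha> < \<kappa> \<Longrightarrow> nbhd x \<alpha> \<in> M"
  by (intro M_open openin_nbhd)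

lemma M_Y: "Y \<in> M" by (rule M_open) (metis openin_topspace topspace_X)

lemma m_Y: "0 < m Y" using M2 unfolding topspace_X .

lemma M_singleton: "x \<in> Y \<Longrightarrow> {x} \<in> M" and m_singleton: "x \<in> Y \<Longrightarrow> m {x} = 0"
  using continuous unfolding topspace_X by simp_all

text \<open>By M5, the measures of the cones around x have infimum \<open>m {x} = 0\<close>, so c
  cannot be a lower bound.\<close>

lemma ex_small_nbhd:
  assumes "x \<in> Y" "0 < c"
  shows "\<exists>\<alpha><\<kappa>. m (nbhd x \<alpha>) < c"
proof (rule ccontr)
  assume "\<not> ?thesis"
  then have "isLb UNIV ((\<lambda>\<alpha>. m (nbhd x \<alpha>)) ` {..<\<kappa>}) c"
    unfolding isLb_def setge_def by (auto intro: leI)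
  moreover have "open_local_basis X x (nbhd x ` {..<\<kappa>})"
    unfolding open_local_basis_def
  proof (intro conjI ballI allI impI)
    show "openin X U" "x \<in> U" if "U \<in> nbhd x ` {..<\<kappa>}" for U
      using that assms(1) openin_nbhd nbhd_self by auto
    show "\<exists>V\<in>nbhd x ` {..<\<kappa>}. V \<subseteq> U" if "openin X U \<and> x \<in> U" for U
      using openin_imp_nbhd[of U x] that by auto
  qed
  then have "isGlb UNIV ((\<lambda>\<alpha>. m (nbhd x \<alpha>)) ` {..<\<kappa>}) (m {x})"
    using assms(1) M_singleton less_card_succ[OF ex_larger card_of_mono1[OF order_refl]]
      M5[of x \<kappa> "nbhd x", unfolded topspace_X] by blast
  ultimately have "c \<le> m {x}" using isGlb_le_isLb by blast
  with assms m_singleton show False by simp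
qed

section \<open>The number of cones, and families of maximal cones\<close>

lemma card_nbhds: "|{nbhd x \<alpha> | x \<alpha>. x \<in> Y \<and> \<alpha> < \<kappa>}| \<le>o |{..<\<kappa>}|"
proof -
  have "|(\<lambda>x. nbhd x \<alpha>) ` Y| \<le>o |{..<\<kappa>}|" if "\<alpha> < \<kappa>" for \<alpha>
  proof -
    \<comment> \<open>A cone of level \<alpha> is coded by the set of places below \<alpha> where
      its points take the value \<open>True\<close>.\<close>
    define g where "g A = {y \<in> Y. \<forall>\<beta><\<alpha>. y \<beta> = Some (\<beta> \<in> A)}" for A
    have "(\<lambda>x. nbhd x \<alpha>) ` Y \<subseteq> g ` Pow {..<\<alpha>}"
    proof (rule image_subsetI)
      fix x assume "x \<in> Y"
      define A where "A = {\<beta>. \<beta> < \<alpha> \<and> x \<beta> = Some True}"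
      have "x \<beta> = Some (\<beta> \<in> A)" if "\<beta> < \<alpha>" for \<beta>
      proof -
        have "\<beta> \<in> dom x" using dom_Y[OF \<open>x \<in> Y\<close>] \<open>\<alpha> < \<kappa>\<close> that by simp
        then obtain b where "x \<beta> = Some b" by blast
        with that show ?thesis by (simp add: A_def)
      qed
      then have "nbhd x \<alpha> = g A" by (simp add: nbhd_def g_def)
      moreover have "A \<in> Pow {..<\<alpha>}" by (auto simp: A_def)
      ultimately show "nbhd x \<alpha> \<in> g ` Pow {..<\<alpha>}" by (rule image_eqI)
    qed
    then have "|(\<lambda>x. nbhd x \<alpha>) ` Y| \<le>o |g ` Pow {..<\<alpha>}|" by (rule card_of_mono1)
    from ordLeq_transitive[OF this ordLeq_transitive[OF card_of_image]] show ?thesis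
      using card_of_Pow_segment[OF two_pow_less that] .
  qed
  then have "|\<Union>\<alpha>\<in>{..<\<kappa>}. (\<lambda>x. nbhd x \<alpha>) ` Y| \<le>o |{..<\<kappa>}|"
    by (intro card_of_UNION_ordLeq_infinite[OF infinite_segment card_of_mono1[OF order_refl]]) simp
  moreover have "(\<Union>\<alpha>\<in>{..<\<kappa>}. (\<lambda>x. nbhd x \<alpha>) ` Y) = {nbhd x \<alpha> | x \<alpha>. x \<in> Y \<and> \<alpha> < \<kappa>}" by auto
  ultimately show ?thesis by simp
qed

text \<open>The inclusion-maximal cones with property P, expressed by least levels. They partition
  the set of points that lie in some cone with P.\<close>

definition maximal_nbhds :: "(('o \<rightharpoonup> bool) set \<Rightarrow> bool) \<Rightarrow> ('o \<rightharpoonup> bool) set set" where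
  "maximal_nbhds P =
     {nbhd x \<alpha> | x \<alpha>. x \<in> Y \<and> \<alpha> < \<kappa> \<and> P (nbhd x \<alpha>) \<and> (\<forall>\<beta><\<alpha>. \<not> P (nbhd x \<beta>))}"

text \<open>A member can be recentred at any of its points x: up to its level, the cones around the
  old centre and around x coincide, so minimality of the level carries over.\<close>

lemma maximal_nbhds_D:
  assumes "U \<in> maximal_nbhds P" "x \<in> U"
  obtains \<alpha> where "\<alpha> < \<kappa>" "U = nbhd x \<alpha>" "P (nbhd x \<alpha>)" "\<And>\<beta>. P (nbhd x \<beta>) \<Longrightarrow> \<alpha> \<le> \<beta>"
proof -
  obtain y \<alpha> where y: "U = nbhd y \<alpha>" "\<alpha> < \<kappa>" "P (nbhd y \<alpha>)" "\<forall>\<beta><\<alpha>. \<not> P (nbhd y \<beta>)"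
    using assms(1) unfolding maximal_nbhds_def by blast
  have "nbhd x \<beta> = nbhd y \<beta>" if "\<beta> \<le> \<alpha>" for \<beta>
    using nbhd_eq nbhd_antimono[OF that] assms(2) y(1) by blast
  with y show ?thesis using that[of \<alpha>] by (metis leI less_imp_le order_refl)
qed

lemma maximal_nbhds_subset: "maximal_nbhds P \<subseteq> {nbhd x \<alpha> | x \<alpha>. x \<in> Y \<and> \<alpha> < \<kappa>}"
  unfolding maximal_nbhds_def by blast

lemma card_maximal_nbhds: "|maximal_nbhds P| \<le>o |{..<\<kappa>}|"
  using card_of_mono1[OF maximal_nbhds_subset] card_nbhds by (rule ordLeq_transitive)

lemma maximal_nbhds_M: "maximal_nbhds P \<subseteq> M"
  using maximal_nbhds_subset M_nbhd by blast

lemma maximal_nbhds_P: "U \<in> maximal_nbhds P \<Longrightarrow> P U"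
  unfolding maximal_nbhds_def by blast

text \<open>Two members sharing a point x are both the cone around x at the least level with
  P.\<close>

lemma disjoint_maximal_nbhds: "disjoint_family_on (\<lambda>U. U) (maximal_nbhds P)"
  unfolding disjoint_family_on_def
proof (intro ballI impI, rule ccontr)
  fix U V assume UV: "U \<in> maximal_nbhds P" "V \<in> maximal_nbhds P" "U \<noteq> V" "U \<inter> V \<noteq> {}"
  then obtain x where "x \<in> U" "x \<in> V" by blast
  with UV(1,2) obtain \<alpha> \<beta> where "U = nbhd x \<alpha>" "P (nbhd x \<alpha>)" "\<And>\<beta>. P (nbhd x \<beta>) \<Longrightarrow> \<alpha> \<le> \<beta>"
    "V = nbhd x \<beta>" "P (nbhd x \<beta>)" "\<And>\<alpha>. P (nbhd x \<alpha>) \<Longrightarrow> \<beta> \<le> \<alpha>"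
    by (metis maximal_nbhds_D)
  with UV(3) show False by (metis order_antisym)
qed

lemma maximal_nbhds_cover:
  assumes "x \<in> Y" "\<alpha> < \<kappa>" "P (nbhd x \<alpha>)"
  obtains \<beta> where "\<beta> < \<kappa>" "nbhd x \<beta> \<in> maximal_nbhds P"
proof -
  define \<beta> where "\<beta> = (LEAST \<beta>. P (nbhd x \<beta>))"
  have "P (nbhd x \<beta>)" unfolding \<beta>_def using assms(3) by (rule LeastI)
  moreover have "\<beta> \<le> \<alpha>" unfolding \<beta>_def using assms(3) by (rule Least_le)
  moreover have "\<not> P (nbhd x \<delta>)" if "\<delta> < \<beta>" for \<delta> using that not_less_Least unfolding \<beta>_def by blast
  ultimately show ?thesis using assms that[of \<beta>] unfolding maximal_nbhds_def by fastforce
qed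

section \<open>The archimedean property, the null part and finiteness of large families\<close>

lemma m_less_multiple:
  assumes "0 < c" "d < m Y"
  shows "\<exists>n. d < multiple n c"
proof (rule ccontr)
  assume "\<not> ?thesis"
  then have le: "multiple n c \<le> d" for n by (simp add: not_less)
  \<comment> \<open>Every point has a cone of measure at most c, so these cones partition Y into at
    most \<kappa> pieces. The bound on multiples of c then forces
    \<open>m Y \<le> d\<close>.\<close>
  let ?J = "maximal_nbhds (\<lambda>U. m U \<le> c)"
  have "m (\<Union>U\<in>?J. U) \<le> d"
    using maximal_nbhds_M maximal_nbhds_P
    by (intro m_UN_le[OF card_maximal_nbhds _ disjoint_maximal_nbhds _ le]) auto
  moreover have "(\<Union>U\<in>?J. U) = Y"
  proof
    show "(\<Union>U\<in>?J. U) \<subseteq> Y" using maximal_nbhds_subset nbhd_subset by blast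
    show "Y \<subseteq> (\<Union>U\<in>?J. U)"
    proof
      fix x assume x: "x \<in> Y"
      then obtain \<alpha> where "\<alpha> < \<kappa>" "m (nbhd x \<alpha>) \<le> c"
        using ex_small_nbhd assms(1) by (meson less_imp_le)
      with x obtain \<beta> where "nbhd x \<beta> \<in> ?J" using maximal_nbhds_cover by metis
      with x show "x \<in> (\<Union>U\<in>?J. U)" using nbhd_self by blast
    qed
  qed
  ultimately show False using assms(2) by simp
qed

text \<open>The union of all null cones, that is, the complement in Y of the support of \<mu>. Using
  only maximal null cones makes the union disjoint.\<close>

definition null_part :: "('o \<rightharpoonup> bool) set" where
  "null_part = (\<Union>U\<in>maximal_nbhds (\<lambda>U. m U = 0). U)"

lemma null_part: "null_part \<in> M" "m null_part = 0"
proof -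
  let ?J = "maximal_nbhds (\<lambda>U. m U = 0)"
  show "null_part \<in> M"
    unfolding null_part_def using maximal_nbhds_M by (intro M_UN card_maximal_nbhds) auto
  show "m null_part = 0"
    unfolding null_part_def using maximal_nbhds_M maximal_nbhds_P
    by (intro m_UN_null[OF card_maximal_nbhds _ disjoint_maximal_nbhds]) auto
qed

lemma m_nbhd_pos:
  assumes "x \<in> Y - null_part" "\<alpha> < \<kappa>"
  shows "0 < m (nbhd x \<alpha>)"
proof (rule ccontr)
  assume "\<not> ?thesis"
  then have "m (nbhd x \<alpha>) = 0" using zero_minimum by (metis le_less)
  then obtain \<beta> where "nbhd x \<beta> \<in> maximal_nbhds (\<lambda>U. m U = 0)"
    using assms maximal_nbhds_cover[of x \<alpha> "\<lambda>U. m U = 0"] by auto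
  then have "x \<in> null_part" unfolding null_part_def using nbhd_self assms(1) by blast
  with assms(1) show False by simp
qed

text \<open>Since \<open>m C < m Y\<close>, some multiple n of c exceeds \<open>m C\<close>, and n
  disjoint members would already have a union of measure at least that multiple.\<close>

lemma finite_if_large:
  assumes "C \<in> M" "m C < m Y" "D ` J \<subseteq> M" "disjoint_family_on D J" "0 < c"
    and "\<And>j. j \<in> J \<Longrightarrow> D j \<subseteq> C" "\<And>j. j \<in> J \<Longrightarrow> c \<le> m (D j)"
  shows "finite J"
proof (rule ccontr)
  assume "infinite J"
  obtain n where n: "m C < multiple n c" using m_less_multiple assms(2,5) by blast
  obtain K where K: "K \<subseteq> J" "finite K" "card K = n"
    using infinite_arbitrarily_large[OF \<open>infinite J\<close>] by blast
  have D: "D ` K \<subseteq> M" "disjoint_family_on D K" "\<forall>j\<in>K. c \<le> m (D j)"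
    using assms(3,4,7) K(1) by (blast intro: disjoint_family_on_mono)+
  have "multiple n c \<le> m (\<Union>j\<in>K. D j)" using m_finite_UN(2)[OF K(2) D(1,2)] D(3) K(3) by blast
  also have "\<dots> \<le> m C" using assms(1,6) K D(1) by (intro M3 M_UN finite_ordLeq) auto
  finally show False using n by simp
qed

section \<open>Points sorted by their first difference from a given point\<close>

definition shell :: "('o \<rightharpoonup> bool) \<Rightarrow> 'o \<Rightarrow> ('o \<rightharpoonup> bool) set" where
  "shell x \<alpha> = {y \<in> nbhd x \<alpha>. y \<alpha> \<noteq> x \<alpha>}"

text \<open>Shells are open: any level above \<alpha> also fixes the coordinate \<alpha>, and such a
  level exists below \<kappa> because \<kappa> is a limit.\<close>

lemma M_shell:
  assumes "\<alpha> < \<kappa>"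
  shows "shell x \<alpha> \<in> M"
proof (intro M_open openin_if_nbhd)
  obtain \<delta> where "\<alpha> < \<delta>" "\<delta> < \<kappa>" using limit[OF assms] by blast
  then show "\<exists>\<delta><\<kappa>. nbhd y \<delta> \<subseteq> shell x \<alpha>" if "y \<in> shell x \<alpha>" for y
    using that by (intro exI[of _ \<delta>]) (auto simp: shell_def nbhd_def)
qed (auto simp: shell_def nbhd_def)

lemma disjoint_shells: "disjoint_family_on (shell x) I"
  unfolding disjoint_family_on_def
proof (intro ballI impI)
  show "shell x \<alpha> \<inter> shell x \<beta> = {}" if "\<alpha> \<noteq> \<beta>" for \<alpha> \<beta>
    using that by (cases \<alpha> \<beta> rule: linorder_cases) (auto simp: shell_def nbhd_def)
qed

lemma nbhd_subset_shells:
  assumes "x \<in> Y"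
  shows "nbhd x \<alpha> \<subseteq> {x} \<union> (\<Union>\<beta>\<in>{\<alpha>..<\<kappa>}. shell x \<beta>)"
proof
  fix y assume y: "y \<in> nbhd x \<alpha>"
  show "y \<in> {x} \<union> (\<Union>\<beta>\<in>{\<alpha>..<\<kappa>}. shell x \<beta>)"
  proof (cases "y = x")
    case False
    then obtain \<delta> where \<delta>: "\<delta> < \<kappa>" "y \<delta> \<noteq> x \<delta>" using Y_eqI assms y nbhd_subset by blast
    define \<beta> where "\<beta> = (LEAST \<delta>. y \<delta> \<noteq> x \<delta>)"
    have "y \<beta> \<noteq> x \<beta>" unfolding \<beta>_def using \<delta>(2) by (rule LeastI)
    moreover have "\<beta> \<le> \<delta>" unfolding \<beta>_def using \<delta>(2) by (rule Least_le)
    moreover have "y \<xi> = x \<xi>" if "\<xi> < \<beta>" for \<xi> using that not_less_Least unfolding \<beta>_def by blast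
    moreover have "\<alpha> \<le> \<beta>" using y \<open>y \<beta> \<noteq> x \<beta>\<close> by (force simp: nbhd_def not_less[symmetric])
    ultimately have "y \<in> shell x \<beta>" "\<beta> \<in> {\<alpha>..<\<kappa>}"
      using y \<delta>(1) by (auto simp: shell_def nbhd_def)
    then show ?thesis by blast
  qed simp
qed

text \<open>Otherwise all shells from some level \<delta> on are null. The cone around x at \<delta>
  is covered by these shells and the null set \<open>{x}\<close>, so it is null, although x lies
  outside the null part.\<close>

lemma infinite_positive_shells:
  assumes x: "x \<in> Y - null_part" and "\<alpha> < \<kappa>"
  shows "infinite {\<beta>. \<alpha> \<le> \<beta> \<and> \<beta> < \<kappa> \<and> 0 < m (shell x \<beta>)}" (is "infinite ?I")
proof
  assume fin: "finite ?I"
  \<comment> \<open>Inserting \<alpha> makes the maximum exist even if \<open>?I\<close> is empty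
    and keeps \<gamma> at or above \<alpha>.\<close>
  define \<gamma> where "\<gamma> = Max (insert \<alpha> ?I)"
  have "\<gamma> \<in> insert \<alpha> ?I" unfolding \<gamma>_def using fin by (intro Max_in) auto
  with assms(2) have "\<gamma> < \<kappa>" by auto
  then obtain \<delta> where \<delta>: "\<gamma> < \<delta>" "\<delta> < \<kappa>" using limit by blast
  have ge: "\<xi> \<le> \<gamma>" if "\<xi> \<in> insert \<alpha> ?I" for \<xi>
    unfolding \<gamma>_def using fin that by (intro Max_ge) auto
  let ?S = "\<Union>\<beta>\<in>{\<delta>..<\<kappa>}. shell x \<beta>"
  have J: "|{\<delta>..<\<kappa>}| \<le>o |{..<\<kappa>}|" by (intro card_of_mono1) auto
  have null: "m (shell x \<beta>) = 0" if "\<beta> \<in> {\<delta>..<\<kappa>}" for \<beta>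
  proof (rule ccontr)
    assume "m (shell x \<beta>) \<noteq> 0"
    then have "0 < m (shell x \<beta>)" using zero_minimum by (metis le_less)
    moreover have "\<alpha> < \<delta>" using ge[of \<alpha>] \<delta>(1) by auto
    ultimately have "\<beta> \<in> ?I" using that by auto
    then show False using ge[of \<beta>] \<delta>(1) that by auto
  qed
  have S: "?S \<in> M" using M_shell by (intro M_UN J) auto
  have "m ?S = 0" using M_shell null by (intro m_UN_null J disjoint_shells) auto
  moreover have "x \<notin> ?S" by (auto simp: shell_def)
  ultimately have "m ({x} \<union> ?S) = 0"
    using m_Un[OF M_singleton S, of x] x by (simp add: m_singleton)
  moreover have "m (nbhd x \<delta>) \<le> m ({x} \<union> ?S)"
    using x S \<delta>(2) nbhd_subset_shells by (intro M3 M_Un M_nbhd M_singleton) auto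
  ultimately show False using m_nbhd_pos[OF x \<delta>(2)] by simp
qed

section \<open>Countably many cones separating almost all points of a positive cone\<close>

lemma contradiction: False
proof -
  have "\<not> Y \<subseteq> null_part"
    using M3[OF M_Y null_part(1)] null_part(2) m_Y by auto
  then obtain x where x: "x \<in> Y - null_part" by blast
  \<comment> \<open>Measure strictly below \<open>m Y\<close> is what \<open>finite_if_large\<close>
    requires of the ambient set.\<close>
  obtain \<alpha> where \<alpha>: "\<alpha> < \<kappa>" "m (nbhd x \<alpha>) < m Y" using ex_small_nbhd m_Y x by blast
  define C where "C = nbhd x \<alpha>"
  have C: "C \<in> M" "m C < m Y" "0 < m C" "C \<subseteq> Y"
    using x \<alpha> M_nbhd m_nbhd_pos nbhd_subset unfolding C_def by auto
  obtain i :: "nat \<Rightarrow> 'o" where i: "inj i" "range i \<subseteq> {\<beta>. \<alpha> \<le> \<beta> \<and> \<beta> < \<kappa> \<and> 0 < m (shell x \<beta>)}"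
    using infinite_countable_subset[OF infinite_positive_shells[OF x \<alpha>(1)]] by blast
  define c where "c k = m (shell x (i k))" for k
  have i_bounds: "\<alpha> \<le> i k" "i k < \<kappa>" and c_pos: "0 < c k" for k
    using i(2) unfolding c_def by blast+
  \<comment> \<open>If d were at most every \<open>c k\<close>, infinitely many disjoint shells
    inside C would have measure at least d.\<close>
  have c_coinitial: "\<exists>k. c k < d" if "0 < d" for d
  proof (rule ccontr)
    assume "\<not> ?thesis"
    then have "d \<le> m (shell x (i k))" for k by (simp add: c_def not_less)
    moreover have "shell x (i k) \<subseteq> C" for k
      using nbhd_antimono[OF i_bounds(1)] unfolding shell_def C_def by blast
    moreover have "disjoint_family (\<lambda>k. shell x (i k))"
      using disjoint_shells i(1) unfolding disjoint_family_on_def by (metis UNIV_I injD)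
    ultimately have "finite (UNIV :: nat set)"
      using M_shell i_bounds(2) that by (intro finite_if_large[OF C(1,2)]) auto
    then show False by simp
  qed
  define F where "F k = {U \<in> maximal_nbhds (\<lambda>U. U \<subseteq> C \<and> m U < c k). 0 < m U}" for k
  have "countable (F k)" for k
  proof -
    have sub: "F k \<subseteq> maximal_nbhds (\<lambda>U. U \<subseteq> C \<and> m U < c k)" unfolding F_def by blast
    \<comment> \<open>Coinitiality of the \<open>c l\<close> splits the positive cones into
      countably many classes, each finite by \<open>finite_if_large\<close>.\<close>
    have "F k \<subseteq> (\<Union>l. {U \<in> F k. c l \<le> m U})"
      using c_coinitial unfolding F_def by (fastforce intro: less_imp_le)
    moreover have "finite {U \<in> F k. c l \<le> m U}" for l
    proof (rule finite_if_large[OF C(1,2) _ _ c_pos[of l]])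
      show "(\<lambda>U. U) ` {U \<in> F k. c l \<le> m U} \<subseteq> M" using sub maximal_nbhds_M by auto
      show "disjoint_family_on (\<lambda>U. U) {U \<in> F k. c l \<le> m U}"
        using disjoint_maximal_nbhds by (rule disjoint_family_on_mono[rotated]) (use sub in blast)
      show "U \<subseteq> C" if "U \<in> {U \<in> F k. c l \<le> m U}" for U
        using that sub maximal_nbhds_P by blast
    qed auto
    then have "countable (\<Union>l. {U \<in> F k. c l \<le> m U})" by (intro countable_UN) (auto intro: countable_finite)
    ultimately show ?thesis by (rule countable_subset)
  qed
  then have "countable (\<Union>k. F k)" by blast
  then obtain e :: "_ \<Rightarrow> nat" where "inj_on e (\<Union>k. F k)" unfolding countable_def by blast
  then have "|\<Union>k. F k| \<le>o |UNIV :: nat set|" by (auto intro: card_of_ordLeqI)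
  \<comment> \<open>The countable family injects into the segment of \<theta>, whose power set has
    size at most \<kappa>.\<close>
  moreover obtain \<theta> where \<theta>: "\<theta> < \<kappa>" "infinite {..<\<theta>}"
    using ex_infinite_segment_less[OF uncountable_segment] by blast
  ultimately have "|\<Union>k. F k| \<le>o |{..<\<theta>}|"
    using infinite_iff_card_of_nat ordLeq_transitive by blast
  then have Pow: "|Pow (\<Union>k. F k)| \<le>o |{..<\<kappa>}|"
    using card_of_Pow_mono card_of_Pow_segment[OF two_pow_less \<theta>(1)] ordLeq_transitive by blast
  define R where "R = C - null_part"
  have R: "R \<subseteq> Y - null_part" using C(4) unfolding R_def by blast
  \<comment> \<open>If y and z differ at \<delta>, a cone of some \<open>F k\<close> around y of
    level above \<delta> contains y but not z.\<close>
  have "inj_on (\<lambda>y. {U \<in> \<Union>k. F k. y \<in> U}) R"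
  proof (rule inj_onI, rule ccontr)
    fix y z
    assume y: "y \<in> R" and z: "z \<in> R" and "y \<noteq> z"
      and eq: "{U \<in> \<Union>k. F k. y \<in> U} = {U \<in> \<Union>k. F k. z \<in> U}"
    have yY: "y \<in> Y - null_part" using y R by blast
    obtain \<delta> where \<delta>: "\<delta> < \<kappa>" "y \<delta> \<noteq> z \<delta>"
      using Y_eqI[of y z] y z R \<open>y \<noteq> z\<close> by blast
    obtain \<delta>' where \<delta>': "\<delta> < \<delta>'" "\<delta>' < \<kappa>" using limit[OF \<delta>(1)] by blast
    \<comment> \<open>This k forces depth: by monotonicity, a cone around y of measure below
      \<open>c k\<close> has level above \<delta>'.\<close>
    obtain k where k: "c k < m (nbhd y \<delta>')" using c_coinitial[OF m_nbhd_pos[OF yY \<delta>'(2)]] by blast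
    obtain \<gamma> where \<gamma>: "\<gamma> < \<kappa>" "m (nbhd y \<gamma>) < c k" using ex_small_nbhd yY c_pos by blast
    \<comment> \<open>Level \<gamma> makes the cone small and level \<alpha> keeps it inside
      C.\<close>
    let ?\<gamma> = "max \<gamma> \<alpha>"
    have "nbhd y ?\<gamma> \<subseteq> nbhd y \<alpha>" by (rule nbhd_antimono) simp
    also have "nbhd y \<alpha> = C" using nbhd_eq y unfolding R_def C_def by blast
    finally have "nbhd y ?\<gamma> \<subseteq> C" .
    moreover have "m (nbhd y ?\<gamma>) \<le> m (nbhd y \<gamma>)"
      using yY \<gamma>(1) \<alpha>(1) by (intro M3 M_nbhd nbhd_antimono) auto
    then have "m (nbhd y ?\<gamma>) < c k" using \<gamma>(2) by simp
    ultimately obtain \<beta> where \<beta>: "\<beta> < \<kappa>" "nbhd y \<beta> \<in> maximal_nbhds (\<lambda>U. U \<subseteq> C \<and> m U < c k)"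
      using maximal_nbhds_cover[of y ?\<gamma> "\<lambda>U. U \<subseteq> C \<and> m U < c k"] yY \<gamma>(1) \<alpha>(1) by auto
    have "m (nbhd y \<beta>) < c k" using maximal_nbhds_P[OF \<beta>(2)] by simp
    then have "\<not> \<beta> \<le> \<delta>'"
      using M3[OF M_nbhd M_nbhd nbhd_antimono, of y \<delta>' \<beta>] k yY \<beta>(1) \<delta>'(2) by auto
    have "nbhd y \<beta> \<in> F k" using \<beta> m_nbhd_pos[OF yY] unfolding F_def by blast
    then have "nbhd y \<beta> \<in> {U \<in> \<Union>k. F k. y \<in> U}" using nbhd_self yY by blast
    then have "z \<in> nbhd y \<beta>" unfolding eq by blast
    then show False using \<open>\<not> \<beta> \<le> \<delta>'\<close> \<delta>'(1) \<delta>(2) by (auto simp: nbhd_def)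
  qed
  then have "|R| \<le>o |Pow (\<Union>k. F k)|" by (rule card_of_ordLeqI) blast
  then have card_R: "|R| \<le>o |{..<\<kappa>}|" using Pow by (rule ordLeq_transitive)
  have "(\<Union>y\<in>R. {y}) \<in> M" using card_R M_singleton R by (intro M_UN) auto
  then have R_M: "R \<in> M" by simp
  \<comment> \<open>R has at most \<kappa> points, each null by continuity of the measure. Together
    with the null part, R covers C, which has positive measure.\<close>
  have "m (\<Union>y\<in>R. {y}) = 0"
    using card_R M_singleton m_singleton R
    by (intro m_UN_null) (auto simp: disjoint_family_on_def)
  then have "m (null_part \<union> R) = 0"
    using m_Un[OF null_part(1) R_M] null_part(2) by (simp add: R_def)
  moreover have "m C \<le> m (null_part \<union> R)"
    using C(1) null_part(1) R_M by (intro M3 M_Un) (auto simp: R_def)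
  ultimately show False using C(3) by simp
qed

end

theorem corollary8p3:
  fixes \<kappa> :: "'o::wellorder"
    and Y :: "('o \<rightharpoonup> bool) set"
  assumes "\<exists>\<nu>::'o. |{..<\<kappa>}| <o |{..<\<nu>}|"
    and "is_cardinal \<kappa>"
    and "is_two_pow_less \<kappa> \<kappa>"
    and "natLeq <o |{..<\<kappa>}|"
    and "Y \<subseteq> cantor \<kappa>"
  shows "\<not> (\<exists>(isum :: ('o \<rightharpoonup> 's::pos_tot_ordered_monoid) \<rightharpoonup> 's) M \<mu>.
           continuous_weak_measure_space \<kappa> (subtopology (bounded_topology \<kappa>) Y) M isum \<mu>)"
proof
  assume "\<exists>(isum :: ('o \<rightharpoonup> 's) \<rightharpoonup> 's) M \<mu>.
           continuous_weak_measure_space \<kappa> (subtopology (bounded_topology \<kappa>) Y) M isum \<mu>"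
  then obtain isum :: "('o \<rightharpoonup> 's) \<rightharpoonup> 's" and M \<mu>
    where cont: "continuous_weak_measure_space \<kappa> (subtopology (bounded_topology \<kappa>) Y) M isum \<mu>"
    by blast
  interpret continuous_weak_measure_space \<kappa> "subtopology (bounded_topology \<kappa>) Y" M isum \<mu>
    by (rule cont)
  have "infinite {..<\<kappa>}"
    using assms(4) infinite_iff_natLeq_ordLeq ordLess_imp_ordLeq by blast
  then interpret continuous_cantor_measure \<kappa> Y M isum \<mu>
    using assms by unfold_locales
  show False by (rule contradiction)
qed

end
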